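(* Consider a storage system with $R=WT$ drives storing a file of $T$ chunks with one (uncoded or coded) chunk per drive, where each drive is blocked in each timeslot with probability $P_b^D$ independently of the other drives and of previous timeslots. At timeslot $t$, the internal blocking probability of the true leader, who has knowledge space rank $r_\ell(t)$, is $$P_b^c=(P_b^D)^{WT-r_\ell(t)}$$ in the network coded storage system, and $$P_b^u=(P_b^D)^{WT-Wr_\ell(t)}$$ in the uncoded storage system.
   Context: **Storage layouts.** A file $\mathcal F=\{f_1,\dots,f_T\}$ is stored on $R=WT$ drives $D_1,\dots,D_{WT}$, where $W\ge1$ is an integer. - Uncoded system: drive $D_{(w-1)T+i}$ stores the $w$-th copy of the single chunk $f_i$, for $w=1,\dots,W$ and $i=1,\dots,T$. - Coded system: drive $D_r$ stores a single coded chunk $c_r=\sum_{j=1}^T\alpha_{j,r}f_j$, $r=1,\dots,H$ with $H=WT$, coefficients being in a finite field. The code is MDS: any $T$ of the encoding vectors $(\alpha_{1,r},\dots,\alpha_{T,r})$ are linearly independent. **Service.** In each timeslot the server may read one chunk from one available (non-blocked) drive and broadcasts it without error to all active users. The rank $r_m(t)$ of user $u_m$ is the rank of the matrix of encoding vectors it has received up to timeslot $t$ (an uncoded chunk $f_j$ has unit encoding vector $\mathbf e_j$). A user is active while $r_m(t)<T$. The true leader $u_\ell$ at timeslot $t$ is the active user with maximum rank $r_\ell(t)$. The server (using a leader-based scheduling scheme) only broadcasts chunks that increase the rank of some active user, so a leader of rank $r_\ell(t)$ has received exactly $r_\ell(t)$ distinct chunks. A drive is useful to the leader if it stores a chunk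 whose reception would increase the leader's rank. The internal blocking probability of the true leader at timeslot $t$ is the probability that no useful drive is available in timeslot $t$, given its rank $r_\ell(t)$. *)

theory Defs
  imports "HOL-Probability.Probability" "HOL-Library.Extended_Nat" "Jordan_Normal_Form.DL_Rank"
begin

text \<open>
  A run of the storage system. Timeslots are numbered \<open>0, 1, 2, \<dots>\<close>, the drives
  \<open>1, \<dots>, copies * chunks\<close>. \<open>enc d\<close> is the encoding vector of the single chunk on drive \<open>d\<close>,
  \<open>blocked t d\<close> the event that drive \<open>d\<close> is blocked in slot \<open>t\<close>, \<open>arrival u\<close> the first slot in which
  user \<open>u\<close> listens (\<open>\<infinity>\<close>: never), and \<open>read t\<close> the drive whose chunk is broadcast in slot \<open>t\<close>
  (\<open>None\<close>: nothing is sent).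
\<close>

record ('k, 'u, 'w) storage_system =
  copies :: nat
  chunks :: nat
  enc :: "nat \<Rightarrow> 'k Matrix.vec"
  blocked :: "nat \<Rightarrow> nat \<Rightarrow> 'w set"
  arrival :: "'u \<Rightarrow> 'w \<Rightarrow> enat"
  read :: "nat \<Rightarrow> 'w \<Rightarrow> nat option"

definition drives :: "('k, 'u, 'w) storage_system \<Rightarrow> nat set" where
  "drives S = {1..copies S * chunks S}"

text \<open>Vector coordinates are counted from 0, so the chunk \<open>f\<^sub>i\<close> has encoding vector \<open>unit_vec T (i - 1)\<close>.\<close>

definition uncoded_storage :: "('k :: {field, finite}, 'u, 'w) storage_system \<Rightarrow> bool" where
  "uncoded_storage S \<longleftrightarrow>
     (\<forall>w\<in>{1..copies S}. \<forall>i\<in>{1..chunks S}.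
        enc S ((w - 1) * chunks S + i) = unit_vec (chunks S) (i - 1))"

text \<open>Linear independence in the AFP library is a property of sets; injectivity turns it into
  independence of the family of encoding vectors.\<close>

definition mds_coded_storage :: "('k :: {field, finite}, 'u, 'w) storage_system \<Rightarrow> bool" where
  "mds_coded_storage S \<longleftrightarrow>
     (\<forall>d\<in>drives S. enc S d \<in> carrier_vec (chunks S)) \<and>
     (\<forall>D\<subseteq>drives S. card D = chunks S \<longrightarrow>
        inj_on (enc S) D \<and>
        module.lin_indpt class_ring (module_vec TYPE('k) (chunks S)) (enc S ` D))"

definition knowledge_rank :: "('k :: {field, finite}, 'u, 'w) storage_system \<Rightarrow> nat list \<Rightarrow> nat" where
  "knowledge_rank S ds = vec_space.rank (chunks S) (mat_of_cols (chunks S) (map (enc S) ds))"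

text \<open>The drives whose chunks \<open>u\<close> has received before the transmission in slot \<open>t\<close>, in order.
  A broadcast reaches exactly the users that have arrived and do not yet have full rank.\<close>

primrec received ::
  "('k :: {field, finite}, 'u, 'w) storage_system \<Rightarrow> nat \<Rightarrow> 'u \<Rightarrow> 'w \<Rightarrow> nat list" where
  "received S 0 u \<omega> = []"
| "received S (Suc t) u \<omega> = received S t u \<omega> @
     (case read S t \<omega> of
        None \<Rightarrow> []
      | Some d \<Rightarrow>
          if arrival S u \<omega> \<le> enat t \<and> knowledge_rank S (received S t u \<omega>) < chunks S
          then [d] else [])"

definition user_rank ::
  "('k :: {field, finite}, 'u, 'w) storage_system \<Rightarrow> nat \<Rightarrow> 'u \<Rightarrow> 'w \<Rightarrow> nat" where
  "user_rank S t u \<omega> = knowledge_rank S (received S t u \<omega>)"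

definition active ::
  "('k :: {field, finite}, 'u, 'w) storage_system \<Rightarrow> nat \<Rightarrow> 'u \<Rightarrow> 'w \<Rightarrow> bool" where
  "active S t u \<omega> \<longleftrightarrow> arrival S u \<omega> \<le> enat t \<and> user_rank S t u \<omega> < chunks S"

definition true_leader ::
  "('k :: {field, finite}, 'u, 'w) storage_system \<Rightarrow> nat \<Rightarrow> 'u \<Rightarrow> 'w \<Rightarrow> bool" where
  "true_leader S t u \<omega> \<longleftrightarrow>
     active S t u \<omega> \<and> (\<forall>v. active S t v \<omega> \<longrightarrow> user_rank S t v \<omega> \<le> user_rank S t u \<omega>)"

definition useful ::
  "('k :: {field, finite}, 'u, 'w) storage_system \<Rightarrow> nat \<Rightarrow> 'u \<Rightarrow> nat \<Rightarrow> 'w \<Rightarrow> bool" where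
  "useful S t u d \<omega> \<longleftrightarrow>
     d \<in> drives S \<and> knowledge_rank S (received S t u \<omega> @ [d]) > user_rank S t u \<omega>"

text \<open>
  \<open>F t\<close> collects everything determined before the drives are polled in slot \<open>t\<close>: all earlier
  drive states and broadcasts, the arrivals up to slot \<open>t\<close>, and any randomisation of the server.
  The broadcast in slot \<open>t\<close> may depend on the drive states in slot \<open>t\<close>, so it is only required
  to be known in \<open>F (Suc t)\<close>. Independence of the drives from each other and from the past is the joint
  independence of the \<open>\<sigma>\<close>-algebra \<open>F t\<close> (index \<open>None\<close>) and of the blocking events in slot \<open>t\<close>
  (index \<open>Some d\<close>).
\<close>

locale storage_service =
  prob_space M + filtration "space M" F
  for M :: "'w measure" and F :: "nat \<Rightarrow> 'w measure" +
  fixes p :: real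
    and S :: "('k :: {field, finite}, 'u :: countable, 'w) storage_system"
  assumes copies_pos: "1 \<le> copies S"
    and chunks_pos: "1 \<le> chunks S"
    and history_subalgebra: "\<And>t. subalgebra M (F t)"
    and arrival_history: "\<And>t u. {\<omega> \<in> space M. arrival S u \<omega> \<le> enat t} \<in> sets (F t)"
    and blocked_history: "\<And>t d. d \<in> drives S \<Longrightarrow> blocked S t d \<in> sets (F (Suc t))"
    and read_history: "\<And>t. read S t \<in> measurable (F (Suc t)) (count_space UNIV)"
    and blocked_prob: "\<And>t d. d \<in> drives S \<Longrightarrow> prob (blocked S t d) = p"
    and blocked_indep:
      "\<And>t. indep_sets (case_option (sets (F t)) (\<lambda>d. {blocked S t d}))
              (insert None (Some ` drives S))"
    and read_drive: "\<And>t \<omega> d. \<omega> \<in> space M \<Longrightarrow> read S t \<omega> = Some d \<Longrightarrow> d \<in> drives S"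
    and read_available: "\<And>t \<omega> d. \<omega> \<in> space M \<Longrightarrow> read S t \<omega> = Some d \<Longrightarrow> \<omega> \<notin> blocked S t d"
    and read_innovative: "\<And>t \<omega> d. \<omega> \<in> space M \<Longrightarrow> read S t \<omega> = Some d \<Longrightarrow>
            \<exists>u. active S t u \<omega> \<and> useful S t u d \<omega>"

text \<open>
  \<open>leader\<close> picks a true leader in slot \<open>t\<close>, breaking ties, from what is known before the drives are
  polled. If no user is active, its value is irrelevant.
\<close>

definition leader_choice ::
  "'w measure \<Rightarrow> (nat \<Rightarrow> 'w measure) \<Rightarrow> ('k :: {field, finite}, 'u, 'w) storage_system
     \<Rightarrow> nat \<Rightarrow> ('w \<Rightarrow> 'u) \<Rightarrow> bool" where
  "leader_choice M F S t leader \<longleftrightarrow>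
     leader \<in> measurable (F t) (count_space UNIV) \<and>
     (\<forall>\<omega>\<in>space M. (\<exists>u. active S t u \<omega>) \<longrightarrow> true_leader S t (leader \<omega>) \<omega>)"

definition leader_has_rank ::
  "('k :: {field, finite}, 'u, 'w) storage_system \<Rightarrow> nat \<Rightarrow> ('w \<Rightarrow> 'u) \<Rightarrow> nat \<Rightarrow> 'w \<Rightarrow> bool" where
  "leader_has_rank S t leader r \<omega> \<longleftrightarrow>
     true_leader S t (leader \<omega>) \<omega> \<and> user_rank S t (leader \<omega>) \<omega> = r"

definition internal_blocking_probability ::
  "'w measure \<Rightarrow> ('k :: {field, finite}, 'u, 'w) storage_system
     \<Rightarrow> nat \<Rightarrow> ('w \<Rightarrow> 'u) \<Rightarrow> nat \<Rightarrow> real" where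
  "internal_blocking_probability M S t leader r =
     cond_prob M
       (\<lambda>\<omega>. \<not> (\<exists>d. useful S t (leader \<omega>) d \<omega> \<and> \<omega> \<notin> blocked S t d))
       (leader_has_rank S t leader r)"

end

theory Submission
  imports Defs
begin

text \<open>
  The set \<open>U\<close> of drives useful to the leader is determined by the chunks it has received, hence known
  before the drives are polled. Splitting along the finitely many values of \<open>U\<close>, the independence of
  the drives from the past gives \<open>P(U \<subseteq> blocked | rank = r) = p\<^sup>n\<close> as soon as \<open>U\<close> has \<open>n\<close> elements
  whenever the leader has rank \<open>r\<close>. With an MDS code, a rank \<open>r < T\<close> means that exactly \<open>r\<close> distinct
  drives were heard, and each of the other \<open>WT - r\<close> drives is useful. Without coding it means that
  \<open>r\<close> residues of drive numbers modulo \<open>T\<close> were heard, and the \<open>W(T - r)\<close> drives in the other residue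
  classes are useful.
\<close>

section \<open>Rank of a matrix with given columns\<close>

lemma (in vec_space) rank_mat_of_cols_indpt:
  assumes "set xs \<subseteq> carrier_vec n" and "lin_indpt (set xs)"
  shows "rank (mat_of_cols n xs) = card (set xs)"
proof -
  have "maximal (set xs) (\<lambda>T. T \<subseteq> set (cols (mat_of_cols n xs)) \<and> lin_indpt T)"
    using assms by (simp add: maximal_def subset_antisym)
  then show ?thesis
    by (rule rank_card_indpt[OF mat_of_cols_carrier(1)])
qed

lemma (in vec_space) rank_mat_of_cols_ge:
  assumes "set xs \<subseteq> carrier_vec n" and "U \<subseteq> set xs" and "lin_indpt U"
  shows "card U \<le> rank (mat_of_cols n xs)"
  using assms rank_ge_card_indpt[OF mat_of_cols_carrier(1)] by simp

text \<open>The cardinality is that of a set of vectors, so repeated receptions and equal copies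
  count once; this form serves both layouts.\<close>

lemma knowledge_rank_indpt:
  fixes S :: "('k :: {field, finite}, 'u, 'w) storage_system"
  assumes "enc S ` set ds \<subseteq> carrier_vec (chunks S)"
    and "module.lin_indpt class_ring (module_vec TYPE('k) (chunks S)) (enc S ` set ds)"
  shows "knowledge_rank S ds = card (enc S ` set ds)"
  using assms vec_space.rank_mat_of_cols_indpt[of "map (enc S) ds" "chunks S"]
  by (simp add: knowledge_rank_def)

section \<open>Ranks and useful drives for an MDS code\<close>

lemma finite_drives [simp]: "finite (drives S)"
  by (simp add: drives_def)

lemma card_drives [simp]: "card (drives S) = copies S * chunks S"
  by (simp add: drives_def)

text \<open>The MDS property speaks of exactly \<open>chunks S\<close> drives. With at least one
  copy, \<open>D\<close> extends to such a set inside \<open>drives S\<close>; injectivity and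
  independence pass down to subsets.\<close>

lemma mds_indpt:
  fixes S :: "('k :: {field, finite}, 'u, 'w) storage_system"
  assumes mds: "mds_coded_storage S" and pos: "1 \<le> copies S"
    and D: "D \<subseteq> drives S" "card D \<le> chunks S"
  shows "inj_on (enc S) D"
    and "module.lin_indpt class_ring (module_vec TYPE('k) (chunks S)) (enc S ` D)"
proof -
  interpret vec_space "TYPE('k)" "chunks S" .
  have "chunks S \<le> card (drives S)"
    using pos by simp
  then obtain E where E: "D \<subseteq> E" "E \<subseteq> drives S" "card E = chunks S"
    using exists_subset_between[OF D(2) _ D(1)] by auto
  then have "inj_on (enc S) E" "lin_indpt (enc S ` E)" "enc S ` E \<subseteq> carrier_vec (chunks S)"
    using mds by (auto simp: mds_coded_storage_def)
  then show "inj_on (enc S) D" "lin_indpt (enc S ` D)"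
    using E(1) subset_li_is_li[of "enc S ` E" "enc S ` D"] by (auto intro: inj_on_subset)
qed

lemma knowledge_rank_mds:
  fixes S :: "('k :: {field, finite}, 'u, 'w) storage_system"
  assumes mds: "mds_coded_storage S" and pos: "1 \<le> copies S"
    and ds: "set ds \<subseteq> drives S" "card (set ds) \<le> chunks S"
  shows "knowledge_rank S ds = card (set ds)"
proof -
  have "enc S ` set ds \<subseteq> carrier_vec (chunks S)"
    using mds ds by (auto simp: mds_coded_storage_def)
  then show ?thesis
    using knowledge_rank_indpt[of S ds] mds_indpt[OF mds pos ds] by (simp add: card_image)
qed

text \<open>Any \<open>chunks S\<close> of the drives heard give independent columns. Used
  contrapositively: a smaller rank forces fewer than \<open>chunks S\<close> distinct drives, where
  \<open>knowledge_rank_mds\<close> applies.\<close>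

lemma knowledge_rank_mds_full:
  fixes S :: "('k :: {field, finite}, 'u, 'w) storage_system"
  assumes mds: "mds_coded_storage S" and pos: "1 \<le> copies S"
    and ds: "set ds \<subseteq> drives S" "chunks S \<le> card (set ds)"
  shows "chunks S \<le> knowledge_rank S ds"
proof -
  obtain E where E: "E \<subseteq> set ds" "card E = chunks S"
    using obtain_subset_with_card_n[OF ds(2)] by blast
  have "E \<subseteq> drives S"
    using E ds by blast
  note indpt = mds_indpt[OF mds pos this]
  have "enc S ` set ds \<subseteq> carrier_vec (chunks S)"
    using mds ds by (auto simp: mds_coded_storage_def)
  then have "card (enc S ` E) \<le> knowledge_rank S ds"
    unfolding knowledge_rank_def
    using E indpt by (intro vec_space.rank_mat_of_cols_ge) auto
  then show ?thesis
    using E indpt(1) by (simp add: card_image)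
qed

text \<open>Stated for a list instead of a user and a sample point, so that the random useful set is
  a fixed function of the received list.\<close>

definition useful_drives ::
  "('k :: {field, finite}, 'u, 'w) storage_system \<Rightarrow> nat list \<Rightarrow> nat set" where
  "useful_drives S ds = {d \<in> drives S. knowledge_rank S ds < knowledge_rank S (ds @ [d])}"

lemma useful_iff: "useful S t u d \<omega> \<longleftrightarrow> d \<in> useful_drives S (received S t u \<omega>)"
  by (simp add: useful_def useful_drives_def user_rank_def)

lemma useful_drives_subset: "useful_drives S ds \<subseteq> drives S"
  by (auto simp: useful_drives_def)

lemma card_useful_drives_mds:
  assumes mds: "mds_coded_storage S" and pos: "1 \<le> copies S"
    and ds: "set ds \<subseteq> drives S" and less: "knowledge_rank S ds < chunks S"
  shows "card (useful_drives S ds) = copies S * chunks S - knowledge_rank S ds"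
proof -
  have card: "card (set ds) < chunks S"
    using knowledge_rank_mds_full[OF mds pos ds] less by linarith
  then have rank: "knowledge_rank S ds = card (set ds)"
    using knowledge_rank_mds[OF mds pos ds] by simp
  \<comment> \<open>The strict bound \<open>card\<close> leaves room for one more drive within the
    range of \<open>knowledge_rank_mds\<close>.\<close>
  have "knowledge_rank S (ds @ [d]) = card (insert d (set ds))" if "d \<in> drives S" for d
    using knowledge_rank_mds[OF mds pos, of "ds @ [d]"] that ds card
    by (simp add: card_insert_if)
  then have "useful_drives S ds = drives S - set ds"
    by (auto simp: useful_drives_def rank card_insert_if)
  then show ?thesis
    using ds by (simp add: rank card_Diff_subset)
qed

section \<open>Ranks and useful drives without coding\<close>

lemma enc_uncoded:
  assumes "uncoded_storage S" and "1 \<le> chunks S" and "d \<in> drives S"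
  shows "enc S d = unit_vec (chunks S) ((d - 1) mod chunks S)"
proof -
  \<comment> \<open>Copies, chunks and drives are numbered from 1, quotients and remainders from 0;
    hence the shifts.\<close>
  define w i where "w = (d - 1) div chunks S + 1" and "i = (d - 1) mod chunks S + 1"
  have d: "d = (w - 1) * chunks S + i"
    using assms(3) by (simp add: w_def i_def drives_def)
  have "d - 1 < copies S * chunks S"
    using assms(3) by (auto simp: drives_def)
  then have "w \<in> {1..copies S}" "i \<in> {1..chunks S}"
    using assms(2) by (auto simp: w_def i_def less_mult_imp_div_less Suc_leI)
  then have "enc S ((w - 1) * chunks S + i) = unit_vec (chunks S) (i - 1)"
    using assms(1) unfolding uncoded_storage_def by blast
  then show ?thesis
    unfolding d[symmetric] by (simp add: i_def)
qed

text \<open>The received vectors belong to the standard basis, hence are independent, and unit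
  vectors of different index differ.\<close>

lemma knowledge_rank_uncoded:
  fixes S :: "('k :: {field, finite}, 'u, 'w) storage_system"
  assumes unc: "uncoded_storage S" and pos: "1 \<le> chunks S" and ds: "set ds \<subseteq> drives S"
  shows "knowledge_rank S ds = card ((\<lambda>d. (d - 1) mod chunks S) ` set ds)"
proof -
  interpret vec_space "TYPE('k)" "chunks S" .
  let ?I = "(\<lambda>d. (d - 1) mod chunks S) ` set ds"
  have I: "?I \<subseteq> {..<chunks S}"
    using pos by auto
  have enc: "enc S ` set ds = unit_vec (chunks S) ` ?I"
    unfolding image_image using enc_uncoded[OF unc pos] ds by (intro image_cong) auto
  have sub: "enc S ` set ds \<subseteq> set (unit_vecs (chunks S))"
    unfolding enc using I by (auto simp: unit_vecs_def)
  moreover have "lin_indpt (set (unit_vecs (chunks S)))"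
    using unit_vecs_basis by (simp add: basis_def)
  ultimately have "lin_indpt (enc S ` set ds)"
    using subset_li_is_li[of "set (unit_vecs (chunks S))" "enc S ` set ds"] by blast
  then have "knowledge_rank S ds = card (enc S ` set ds)"
    using sub unit_vecs_carrier by (intro knowledge_rank_indpt) blast+
  also have "\<dots> = card ?I"
    unfolding enc using I by (intro card_image inj_onI) (auto simp: unit_vec_eq)
  finally show ?thesis .
qed

text \<open>Dividing \<open>d - 1\<close> by \<open>chunks S\<close> identifies drives with pairs of
  copy and residue, so each residue class has one drive per copy.\<close>

lemma card_drives_residues:
  assumes "I \<subseteq> {..<chunks S}"
  shows "card {d \<in> drives S. (d - 1) mod chunks S \<in> I} = copies S * card I"
proof -
  have "bij_betw (\<lambda>(w, i). w * chunks S + i + 1) ({..<copies S} \<times> I)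
      {d \<in> drives S. (d - 1) mod chunks S \<in> I}"
  proof (rule bij_betwI[where g = "\<lambda>d. ((d - 1) div chunks S, (d - 1) mod chunks S)"])
    have "w * chunks S + i + 1 \<in> drives S" if "w < copies S" "i \<in> I" for w i
    proof -
      have "Suc w * chunks S \<le> copies S * chunks S"
        using that by (intro mult_le_mono1) simp
      moreover have "i < chunks S"
        using that assms by auto
      ultimately show ?thesis
        by (simp add: drives_def)
    qed
    then show "(\<lambda>(w, i). w * chunks S + i + 1) \<in> {..<copies S} \<times> I \<rightarrow>
        {d \<in> drives S. (d - 1) mod chunks S \<in> I}"
      using assms by auto
    show "(\<lambda>d. ((d - 1) div chunks S, (d - 1) mod chunks S)) \<in>
        {d \<in> drives S. (d - 1) mod chunks S \<in> I} \<rightarrow> {..<copies S} \<times> I"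
      by (auto simp: drives_def less_mult_imp_div_less)
  qed (use assms in \<open>auto simp: drives_def\<close>)
  then show ?thesis
    by (auto dest!: bij_betw_same_card simp: card_cartesian_product)
qed

lemma card_useful_drives_uncoded:
  assumes unc: "uncoded_storage S" and pos: "1 \<le> chunks S" and ds: "set ds \<subseteq> drives S"
  shows "card (useful_drives S ds) = copies S * chunks S - copies S * knowledge_rank S ds"
proof -
  define I where "I = (\<lambda>d. (d - 1) mod chunks S) ` set ds"
  have I: "I \<subseteq> {..<chunks S}" "finite I"
    using pos by (auto simp: I_def)
  have rank: "knowledge_rank S ds = card I"
    using knowledge_rank_uncoded[OF unc pos ds] by (simp add: I_def)
  have "knowledge_rank S (ds @ [d]) = card (insert ((d - 1) mod chunks S) I)"
    if "d \<in> drives S" for d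
    using knowledge_rank_uncoded[OF unc pos, of "ds @ [d]"] that ds by (simp add: I_def)
  \<comment> \<open>A drive raises the rank exactly when its residue is new.\<close>
  then have "useful_drives S ds = {d \<in> drives S. (d - 1) mod chunks S \<in> {..<chunks S} - I}"
    using pos I by (auto simp: useful_drives_def rank card_insert_if)
  then have "card (useful_drives S ds) = copies S * card ({..<chunks S} - I)"
    using card_drives_residues[of "{..<chunks S} - I" S] by simp
  then show ?thesis
    using I by (simp add: rank card_Diff_subset diff_mult_distrib2)
qed

section \<open>Measurability of the leader's state in the history\<close>

context storage_service
begin

lemma received_subset_drives: "\<omega> \<in> space M \<Longrightarrow> set (received S t u \<omega>) \<subseteq> drives S"
  by (induction t) (auto split: option.split dest: read_drive[OF _ sym])

lemma measurable_F_mono: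
  assumes "f \<in> measurable (F s) N" and "s \<le> t"
  shows "f \<in> measurable (F t) N"
  using assms sets_F_mono[of s t] by (auto simp: measurable_def space_F)

lemma arrival_measurable: "Measurable.pred (F t) (\<lambda>\<omega>. arrival S u \<omega> \<le> enat t)"
  using arrival_history[of u t] by (simp add: pred_def space_F)

text \<open>Only broadcasts before slot \<open>t\<close> matter, and the broadcast of slot
  \<open>t\<close> is known in \<open>F (Suc t)\<close>, so the indices match in the
  induction.\<close>

lemma received_measurable: "received S t u \<in> measurable (F t) (count_space UNIV)"
proof (induction t)
  case 0
  have "received S 0 u = (\<lambda>_. [])"
    by (rule ext) simp
  then show ?case
    by (simp only: measurable_count_space_const)
next
  case (Suc t)
  \<comment> \<open>The received list \<open>ds\<close> and the broadcast \<open>c\<close> have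
    countable types, so each can be fixed at a value; what remains random is one arrival
    event.\<close>
  let ?f = "\<lambda>ds c \<omega>. ds @ (case c of None \<Rightarrow> []
      | Some d \<Rightarrow> if arrival S u \<omega> \<le> enat t \<and> knowledge_rank S ds < chunks S then [d] else [])"
  note received = measurable_F_mono[OF Suc le_SucI[OF order_refl]]
  have arrival: "Measurable.pred (F (Suc t)) (\<lambda>\<omega>. arrival S u \<omega> \<le> enat t)"
    using measurable_F_mono[OF arrival_measurable le_SucI[OF order_refl]] .
  have f: "?f ds c \<in> measurable (F (Suc t)) (count_space UNIV)" for ds c
    by (rule measurable_compose[where g = "\<lambda>b. ds @ (case c of None \<Rightarrow> []
      | Some d \<Rightarrow> if b \<and> knowledge_rank S ds < chunks S then [d] else [])", OF arrival])
      (rule measurable_count_space)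
  have "(\<lambda>\<omega>. ?f (received S t u \<omega>) c \<omega>) \<in> measurable (F (Suc t)) (count_space UNIV)" for c
    by (rule measurable_compose_countable[where f = "\<lambda>ds. ?f ds c", OF f received])
  then have "(\<lambda>\<omega>. ?f (received S t u \<omega>) (read S t \<omega>) \<omega>)
      \<in> measurable (F (Suc t)) (count_space UNIV)"
    by (rule measurable_compose_countable[
        where f = "\<lambda>c \<omega>. ?f (received S t u \<omega>) c \<omega>", OF _ read_history])
  moreover have "received S (Suc t) u = (\<lambda>\<omega>. ?f (received S t u \<omega>) (read S t \<omega>) \<omega>)"
    by (rule ext) simp
  ultimately show ?case
    by (simp only:)
qed

lemma received_pred: "Measurable.pred (F t) (\<lambda>\<omega>. P (received S t u \<omega>))"
  by (rule measurable_compose[OF received_measurable]) simp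

lemma active_measurable: "Measurable.pred (F t) (active S t u)"
  unfolding active_def user_rank_def
  by (intro pred_intros_logic arrival_measurable received_pred)

lemma true_leader_measurable: "Measurable.pred (F t) (true_leader S t u)"
proof -
  have "Measurable.pred (F t) (\<lambda>\<omega>. user_rank S t v \<omega> \<le> user_rank S t u \<omega>)" for v
    unfolding user_rank_def
    by (rule measurable_compose_countable[
          where f = "\<lambda>ds \<omega>. knowledge_rank S (received S t v \<omega>) \<le> knowledge_rank S ds",
          OF received_pred received_measurable])
  \<comment> \<open>Users form a countable type, so quantifying over all rivals preserves
    measurability.\<close>
  then show ?thesis
    unfolding true_leader_def
    by (intro pred_intros_logic pred_intros_countable active_measurable)
qed

text \<open>The leader is random: measurability holds for each fixed user \<open>u\<close>, and the
  countably many cases are glued along \<open>leader\<close>. Independence is later applied to these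
  events.\<close>

lemma leader_history:
  assumes leader: "leader \<in> measurable (F t) (count_space UNIV)"
  shows "{\<omega> \<in> space M. leader_has_rank S t leader r \<omega> \<and>
    useful_drives S (received S t (leader \<omega>) \<omega>) = D} \<in> sets (F t)"
proof -
  have "Measurable.pred (F t) (\<lambda>\<omega>. (true_leader S t u \<omega> \<and> user_rank S t u \<omega> = r) \<and>
      useful_drives S (received S t u \<omega>) = D)" for u
    unfolding user_rank_def
    by (intro pred_intros_logic true_leader_measurable received_pred)
  then have "Measurable.pred (F t) (\<lambda>\<omega>. leader_has_rank S t leader r \<omega> \<and>
      useful_drives S (received S t (leader \<omega>) \<omega>) = D)"
    unfolding leader_has_rank_def
    by (rule measurable_compose_countable[where f = "\<lambda>u \<omega>.
          (true_leader S t u \<omega> \<and> user_rank S t u \<omega> = r) \<and> useful_drives S (received S t u \<omega>) = D",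
          OF _ leader])
  then show ?thesis
    by (simp add: pred_def space_F)
qed

section \<open>Independence and the conditional probability\<close>

lemma prob_history_blocked:
  assumes A: "A \<in> sets (F t)" and D: "D \<subseteq> drives S"
  shows "prob {\<omega> \<in> A. \<forall>d\<in>D. \<omega> \<in> blocked S t d} = prob A * p ^ card D"
proof -
  have fin: "finite D"
    by (rule finite_subset[OF D finite_drives])
  \<comment> \<open>Index \<open>None\<close> carries the history event, \<open>Some d\<close> the
    blocking of \<open>d\<close>. With \<open>None\<close> the index set is nonempty even if
    \<open>D\<close> is empty.\<close>
  let ?X = "case_option A (blocked S t)"
  have "prob (\<Inter>j\<in>insert None (Some ` D). ?X j) = (\<Prod>j\<in>insert None (Some ` D). prob (?X j))"
    using A D fin by (intro indep_setsD[OF blocked_indep[of t]]) auto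
  also have "\<dots> = prob A * (\<Prod>d\<in>D. prob (blocked S t d))"
    using fin by (simp add: prod.reindex)
  also have "(\<Prod>d\<in>D. prob (blocked S t d)) = p ^ card D"
    using D blocked_prob by (subst prod.cong[OF refl, of _ _ "\<lambda>_. p"]) auto
  also have "(\<Inter>j\<in>insert None (Some ` D). ?X j) = {\<omega> \<in> A. \<forall>d\<in>D. \<omega> \<in> blocked S t d}"
    by auto
  finally show ?thesis .
qed

text \<open>The layout enters only through \<open>n\<close>: the useful set may vary with the sample
  point as long as its size does not.\<close>

lemma internal_blocking_probability_eq:
  assumes leader: "leader \<in> measurable (F t) (count_space UNIV)"
    and pos: "prob {\<omega> \<in> space M. leader_has_rank S t leader r \<omega>} > 0"
    and card: "\<And>\<omega>. \<omega> \<in> space M \<Longrightarrow> leader_has_rank S t leader r \<omega> \<Longrightarrow>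
      card (useful_drives S (received S t (leader \<omega>) \<omega>)) = n"
  shows "internal_blocking_probability M S t leader r = p ^ n"
proof -
  let ?U = "\<lambda>\<omega>. useful_drives S (received S t (leader \<omega>) \<omega>)"
  let ?L = "leader_has_rank S t leader r"
  \<comment> \<open>\<open>A D\<close> fixes the useful set to be \<open>D\<close>, which makes
    these events disjoint; \<open>B D\<close> adds that all of \<open>D\<close> is blocked.\<close>
  define A where "A D = {\<omega> \<in> space M. ?L \<omega> \<and> ?U \<omega> = D}" for D
  define B where "B D = {\<omega> \<in> A D. \<forall>d\<in>D. \<omega> \<in> blocked S t d}" for D
  have A_F: "A D \<in> sets (F t)" for D
    unfolding A_def by (rule leader_history[OF leader])
  have A: "A D \<in> events" for D
    using A_F[of D] history_subalgebra[of t] by (auto simp: subalgebra_def)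
  have blocked: "blocked S t d \<in> events" if "d \<in> drives S" for d
    using blocked_history[OF that, of t] history_subalgebra[of "Suc t"] by (auto simp: subalgebra_def)
  have B: "B D \<in> events" if "D \<in> Pow (drives S)" for D
  proof -
    have "B D = A D \<inter> (\<Inter>d\<in>D. blocked S t d \<inter> space M) " if "D \<noteq> {}"
      using that by (auto simp: B_def A_def)
    moreover have "finite D"
      using that by (auto intro: finite_subset[OF _ finite_drives])
    ultimately show ?thesis
      using that A blocked by (cases "D = {}") (auto simp: B_def intro!: sets.Int sets.finite_INT)
  qed
  have prob_B: "prob (B D) = prob (A D) * p ^ n" if "D \<in> Pow (drives S)" for D
  \<comment> \<open>The size of \<open>D\<close> is known only if some sample point attains
    \<open>D\<close>; otherwise both sides vanish.\<close>
  proof (cases "A D = {}")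
    case False
    then have "card D = n"
      using card by (auto simp: A_def)
    then show ?thesis
      using prob_history_blocked[OF A_F, of D D] that by (simp add: B_def)
  qed (simp add: B_def)
  have "{\<omega> \<in> space M. \<not> (\<exists>d. useful S t (leader \<omega>) d \<omega> \<and> \<omega> \<notin> blocked S t d) \<and> ?L \<omega>} =
      (\<Union>D\<in>Pow (drives S). B D)"
    using useful_drives_subset by (fastforce simp: useful_iff A_def B_def)
  also have "prob \<dots> = (\<Sum>D\<in>Pow (drives S). prob (B D))"
    using B by (intro finite_measure_finite_Union) (auto simp: disjoint_family_on_def B_def A_def)
  also have "\<dots> = (\<Sum>D\<in>Pow (drives S). prob (A D)) * p ^ n"
    by (simp add: prob_B sum_distrib_right)
  also have "(\<Sum>D\<in>Pow (drives S). prob (A D)) = prob (\<Union>D\<in>Pow (drives S). A D)"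
    using A by (intro finite_measure_finite_Union[symmetric]) (auto simp: disjoint_family_on_def A_def)
  also have "(\<Union>D\<in>Pow (drives S). A D) = {\<omega> \<in> space M. ?L \<omega>}"
    using useful_drives_subset by (fastforce simp: A_def)
  finally show ?thesis
    using pos by (simp add: internal_blocking_probability_def cond_prob_def)
qed

end

theorem lemma6:
  fixes M :: "'w measure"
    and F :: "nat \<Rightarrow> 'w measure"
    and p :: real
    and S :: "('k :: {field, finite}, 'u :: countable, 'w) storage_system"
    and leader :: "'w \<Rightarrow> 'u"
    and t r :: nat
  assumes "storage_service M F p S"
    and "leader_choice M F S t leader"
    and "measure M {\<omega> \<in> space M. leader_has_rank S t leader r \<omega>} > 0"
  shows "(mds_coded_storage S \<longrightarrow>
            internal_blocking_probability M S t leader r = p ^ (copies S * chunks S - r)) \<and>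
         (uncoded_storage S \<longrightarrow>
            internal_blocking_probability M S t leader r = p ^ (copies S * chunks S - copies S * r))"
proof -
  interpret storage_service M F p S
    by (rule assms(1))
  have leader: "leader \<in> measurable (F t) (count_space UNIV)"
    using assms(2) by (simp add: leader_choice_def)
  note eq = internal_blocking_probability_eq[OF leader assms(3)]
  \<comment> \<open>The leader is active, which gives the strict bound required by the MDS
    count.\<close>
  have rank: "knowledge_rank S (received S t (leader \<omega>) \<omega>) = r" "r < chunks S"
    if "leader_has_rank S t leader r \<omega>" for \<omega>
    using that by (auto simp: leader_has_rank_def true_leader_def active_def user_rank_def)
  show ?thesis
  proof (intro conjI impI)
    assume mds: "mds_coded_storage S"
    show "internal_blocking_probability M S t leader r = p ^ (copies S * chunks S - r)"
      using card_useful_drives_mds[OF mds copies_pos received_subset_drives] rank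
      by (intro eq) simp
  next
    assume unc: "uncoded_storage S"
    show "internal_blocking_probability M S t leader r = p ^ (copies S * chunks S - copies S * r)"
      using card_useful_drives_uncoded[OF unc chunks_pos received_subset_drives] rank
      by (intro eq) simp
  qed
qed

end
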